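(* Let $\varepsilon>0$. For a dataset $D=[x]$ of $n$ records $x_i\in[0,1]$, let $Z_0,Z_1,Z_2$ be independent $\mathrm{Lap}(1/\varepsilon)$ random variables and set $$\tilde b_0=\sum_{i=1}^n(1-x_i)^2+Z_0,\quad \tilde b_1=\sum_{i=1}^n 2x_i(1-x_i)+Z_1,\quad \tilde b_2=\sum_{i=1}^n x_i^2+Z_2,$$ $\tilde n=\tilde b_0+\tilde b_1+\tilde b_2$, $\tilde s_x=\tilde b_1/2+\tilde b_2$, $\tilde s_{x^2}=\tilde b_2$, and $$\hat v_b(D)=\mathrm{clip}\!\left(\frac{\tilde s_{x^2}}{\tilde n}-\left(\frac{\tilde s_x}{\tilde n}\right)^2,\ [0,1/4]\right).$$ Then $$R(\hat v_b,\mathrm{Var},n_0)\le\frac{2}{\varepsilon^2}(1+o(1)),$$ where $o(1)\to0$ as $n_0\to\infty$ (with $\varepsilon$ fixed).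
   Context: $\mathrm{Lap}(b)$ is the Laplace distribution with density $\frac1{2b}e^{-|t|/b}$. $\mathrm{clip}(t,[l,u])=\max\{l,\min\{u,t\}\}$. (The event $\tilde n=0$ has probability $0$; the value there is irrelevant.) $\mathrm{Var}([x])=\frac1n\sum_{i=1}^n x_i^2-\left(\frac1n\sum_{i=1}^n x_i\right)^2$ for a dataset $[x]$ of $n\ge1$ records in $[0,1]$. For a randomized estimator $\hat f$ of a real-valued statistic $f$ of datasets, $R(\hat f,f,D)=|D|^2\,\mathbb E[(\hat f(D)-f(D))^2]$, where $|D|$ is the number of records and the expectation is over the randomness of $\hat f$, and $R(\hat f,f,n_0)=\sup\{R(\hat f,f,D): |D|\ge n_0\}$, the supremum being over all datasets (here with records in $[0,1]$) of size at least $n_0$. *)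

theory Defs
  imports "HOL-Probability.Probability"
begin

definition laplace_density :: "real \<Rightarrow> real \<Rightarrow> real" where
  "laplace_density b t = 1 / (2 * b) * exp (- \<bar>t\<bar> / b)"

definition clip :: "real \<Rightarrow> real \<Rightarrow> real \<Rightarrow> real" where
  "clip t l u = max l (min u t)"

text \<open>A dataset is the list of its records.\<close>

definition Var :: "real list \<Rightarrow> real" where
  "Var D = (\<Sum>x\<leftarrow>D. x\<^sup>2) / real (length D) - ((\<Sum>x\<leftarrow>D. x) / real (length D))\<^sup>2"

text \<open>A randomized estimator on a probability space \<open>M\<close> assigns to every dataset a real random
  variable on \<open>M\<close>. Risks take values in \<^typ>\<open>ennreal\<close>, so that neither the expectation nor the
  supremum gets a default value when it is infinite.\<close>

definition risk ::
  "'a measure \<Rightarrow> (real list \<Rightarrow> 'a \<Rightarrow> real) \<Rightarrow> (real list \<Rightarrow> real) \<Rightarrow> real list \<Rightarrow> ennreal" where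
  "risk M fh f D = of_nat (length D) ^ 2 * (\<integral>\<^sup>+\<omega>. ennreal ((fh D \<omega> - f D)\<^sup>2) \<partial>M)"

definition worst_risk ::
  "'a measure \<Rightarrow> (real list \<Rightarrow> 'a \<Rightarrow> real) \<Rightarrow> (real list \<Rightarrow> real) \<Rightarrow> nat \<Rightarrow> ennreal" where
  "worst_risk M fh f n0 = (SUP D\<in>{D. set D \<subseteq> {0..1} \<and> n0 \<le> length D}. risk M fh f D)"

text \<open>The same noise variables \<open>Z\<close> serve all datasets; this is immaterial for the risks above, which
  depend only on the distribution of the estimate for each single dataset.\<close>

definition var_estimator :: "(nat \<Rightarrow> 'a \<Rightarrow> real) \<Rightarrow> real list \<Rightarrow> 'a \<Rightarrow> real" where
  "var_estimator Z D \<omega> =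
    (let b0 = (\<Sum>x\<leftarrow>D. (1 - x)\<^sup>2) + Z 0 \<omega>;
         b1 = (\<Sum>x\<leftarrow>D. 2 * x * (1 - x)) + Z 1 \<omega>;
         b2 = (\<Sum>x\<leftarrow>D. x\<^sup>2) + Z 2 \<omega>;
         n = b0 + b1 + b2;
         s_x = b1 / 2 + b2;
         s_x2 = b2
     in clip (s_x2 / n - (s_x / n)\<^sup>2) 0 (1 / 4))"

end

theory Submission
  imports Defs
begin

text \<open>
  Let \<open>m\<close> and \<open>q\<close> be the means of \<open>x\<close> and \<open>x\<^sup>2\<close> over \<open>D\<close>. To first order in the noise,
  \<open>n\<close> times the error of the estimator is \<open>L = c Z\<^sub>0 + (c - m) Z\<^sub>1 + (1 - 2 m + c) Z\<^sub>2\<close> with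
  \<open>c = 2 m\<^sup>2 - q\<close>. Since \<open>m\<^sup>2 \<le> q \<le> m\<close>, the squares of the three coefficients add up to at most
  \<open>1\<close>, so \<open>L\<close> has variance at most \<open>2 / \<epsilon>\<^sup>2\<close>. The remainder in \<open>(n \<cdot> error)\<^sup>2 \<le> L\<^sup>2 + O(1 / n)\<close> is
  controlled by the fourth moments of the noise, uniformly in \<open>D\<close>: if the noise is at most \<open>n / 2\<close>,
  the denominator is at least \<open>n / 2\<close> and the expansion applies; otherwise clipping bounds the
  error by \<open>1 / 4\<close>, and \<open>n\<^sup>2\<close> is at most \<open>8 W\<^sup>3 / n\<close> for \<open>W = \<bar>Z\<^sub>0\<bar> + \<bar>Z\<^sub>1\<bar> + \<bar>Z\<^sub>2\<bar>\<close>.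
\<close>

section \<open>Moments of the Laplace distribution\<close>

lemma has_bochner_integral_exponential_density_moment:
  assumes "0 < l"
  shows "has_bochner_integral lborel (\<lambda>x. exponential_density l x * x ^ i) (fact i / l ^ i)"
proof (rule has_bochner_integral_nn_integral)
  show "(\<integral>\<^sup>+x. ennreal (exponential_density l x * x ^ i) \<partial>lborel) = ennreal (fact i / l ^ i)"
    using nn_integral_erlang_ith_moment[OF assms, of 0 i] by simp
qed (use assms in \<open>auto simp: erlang_density_def\<close>)

lemma has_bochner_integral_laplace_density_moment:
  assumes "0 < b"
  shows "has_bochner_integral lborel (\<lambda>t. laplace_density b t * t ^ i)
    (if even i then fact i * b ^ i else 0)"
proof -
  \<comment> \<open>Away from \<open>0\<close>, the Laplace density is half the sum of the exponential density and its
    mirror image.\<close>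
  let ?f = "\<lambda>t. exponential_density (1 / b) t * t ^ i"
  have pos: "has_bochner_integral lborel ?f (fact i * b ^ i)"
    using has_bochner_integral_exponential_density_moment[of "1 / b" i] assms
    by (simp add: power_one_over)
  then have neg: "has_bochner_integral lborel (\<lambda>t. ?f (- t)) (fact i * b ^ i)"
    using lborel_has_bochner_integral_real_affine_iff[of "-1" ?f "fact i * b ^ i" 0] by simp
  have "has_bochner_integral lborel (\<lambda>t. (?f t + (- 1) ^ i * ?f (- t)) / 2)
      ((fact i * b ^ i + (- 1) ^ i * (fact i * b ^ i)) / 2)"
    by (intro has_bochner_integral_divide_zero has_bochner_integral_add
        has_bochner_integral_mult_right pos neg)
  also have "(fact i * b ^ i + (- 1) ^ i * (fact i * b ^ i)) / 2 =
      (if even i then fact i * b ^ i else 0)"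
    by simp
  also have "has_bochner_integral lborel (\<lambda>t. (?f t + (- 1) ^ i * ?f (- t)) / 2)
        (if even i then fact i * b ^ i else 0) \<longleftrightarrow>
      has_bochner_integral lborel (\<lambda>t. laplace_density b t * t ^ i)
        (if even i then fact i * b ^ i else 0)"
  proof (rule has_bochner_integral_cong_AE)
    show "AE t in lborel. (?f t + (- 1) ^ i * ?f (- t)) / 2 = laplace_density b t * t ^ i"
      using AE_lborel_singleton[of 0]
    proof eventually_elim
      case (elim t)
      have "(- 1) ^ i * (- t) ^ i = t ^ i"
        by (simp flip: power_mult_distrib)
      then show ?case
        using elim assms
        by (cases "t < 0") (auto simp: erlang_density_def laplace_density_def field_simps)
    qed
  qed (auto simp: laplace_density_def)
  finally show ?thesis .
qed

lemma laplace_density_nonneg: "0 \<le> b \<Longrightarrow> 0 \<le> laplace_density b t"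
  by (simp add: laplace_density_def)

lemma
  assumes "distributed M lborel X (\<lambda>t. ennreal (laplace_density b t))" and "0 < b"
  shows integrable_laplace_moment: "integrable M (\<lambda>\<omega>. X \<omega> ^ i)"
    and integral_laplace_moment:
      "(\<integral>\<omega>. X \<omega> ^ i \<partial>M) = (if even i then fact i * b ^ i else 0)"
proof -
  note m = has_bochner_integral_laplace_density_moment[OF \<open>0 < b\<close>, of i]
  show "integrable M (\<lambda>\<omega>. X \<omega> ^ i)"
    using distributed_integrable[OF assms(1), of "\<lambda>t. t ^ i"] assms(2) m
    by (simp add: laplace_density_nonneg has_bochner_integral_iff)
  show "(\<integral>\<omega>. X \<omega> ^ i \<partial>M) = (if even i then fact i * b ^ i else 0)"
    using distributed_integral[OF assms(1), of "\<lambda>t. t ^ i"] assms(2) m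
    by (simp add: laplace_density_nonneg has_bochner_integral_iff)
qed

section \<open>Second moments of linear combinations of independent variables\<close>

text \<open>Expanding the square leaves only the diagonal terms: for \<open>i \<noteq> j\<close>,
  independence makes \<open>X i * X j\<close> integrable with expectation the product of two zero
  means.\<close>

lemma (in prob_space) expectation_square_lincomb_indep:
  fixes X :: "'i \<Rightarrow> 'a \<Rightarrow> real"
  assumes fin: "finite I"
    and ind: "indep_vars (\<lambda>_. borel) X I"
    and int: "\<And>i. i \<in> I \<Longrightarrow> integrable M (X i)"
    and sq: "\<And>i. i \<in> I \<Longrightarrow> integrable M (\<lambda>\<omega>. (X i \<omega>)\<^sup>2)"
    and zero: "\<And>i. i \<in> I \<Longrightarrow> expectation (X i) = 0"
  shows "integrable M (\<lambda>\<omega>. (\<Sum>i\<in>I. a i * X i \<omega>)\<^sup>2)"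
    and "expectation (\<lambda>\<omega>. (\<Sum>i\<in>I. a i * X i \<omega>)\<^sup>2) =
      (\<Sum>i\<in>I. (a i)\<^sup>2 * expectation (\<lambda>\<omega>. (X i \<omega>)\<^sup>2))"
proof -
  have prod: "integrable M (\<lambda>\<omega>. X i \<omega> * X j \<omega>)"
    "expectation (\<lambda>\<omega>. X i \<omega> * X j \<omega>) = (if i = j then expectation (\<lambda>\<omega>. (X i \<omega>)\<^sup>2) else 0)"
    if "i \<in> I" "j \<in> I" for i j
  proof -
    have "integrable M (\<lambda>\<omega>. X i \<omega> * X j \<omega>) \<and> expectation (\<lambda>\<omega>. X i \<omega> * X j \<omega>) = 0" if "i \<noteq> j"
    proof -
      have "indep_vars (\<lambda>_. borel) X {i, j}"
        by (rule indep_vars_subset[OF ind]) (use \<open>i \<in> I\<close> \<open>j \<in> I\<close> in auto)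
      moreover have "\<And>k. k \<in> {i, j} \<Longrightarrow> integrable M (X k)"
        using int \<open>i \<in> I\<close> \<open>j \<in> I\<close> by auto
      ultimately show ?thesis
        using indep_vars_lebesgue_integral[of "{i, j}" X] indep_vars_integrable[of "{i, j}" X]
          that zero[OF \<open>i \<in> I\<close>] by simp
    qed
    then show "integrable M (\<lambda>\<omega>. X i \<omega> * X j \<omega>)"
      "expectation (\<lambda>\<omega>. X i \<omega> * X j \<omega>) = (if i = j then expectation (\<lambda>\<omega>. (X i \<omega>)\<^sup>2) else 0)"
      using sq[OF that(1)] by (auto simp: power2_eq_square)
  qed
  have eq: "(\<Sum>i\<in>I. a i * X i \<omega>)\<^sup>2 = (\<Sum>i\<in>I. \<Sum>j\<in>I. a i * a j * (X i \<omega> * X j \<omega>))" for \<omega>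
    by (simp add: power2_eq_square sum_product algebra_simps)
  show "integrable M (\<lambda>\<omega>. (\<Sum>i\<in>I. a i * X i \<omega>)\<^sup>2)"
    unfolding eq by (intro Bochner_Integration.integrable_sum integrable_mult_right prod)
  have "expectation (\<lambda>\<omega>. (\<Sum>i\<in>I. a i * X i \<omega>)\<^sup>2) =
      (\<Sum>i\<in>I. \<Sum>j\<in>I. a i * a j * expectation (\<lambda>\<omega>. X i \<omega> * X j \<omega>))"
    unfolding eq using prod(1) by (simp add: Bochner_Integration.integral_sum)
  also have "\<dots> = (\<Sum>i\<in>I. \<Sum>j\<in>I. if i = j then (a i)\<^sup>2 * expectation (\<lambda>\<omega>. (X i \<omega>)\<^sup>2) else 0)"
    by (intro sum.cong refl) (simp add: prod(2), simp add: power2_eq_square)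
  also have "\<dots> = (\<Sum>i\<in>I. (a i)\<^sup>2 * expectation (\<lambda>\<omega>. (X i \<omega>)\<^sup>2))"
    using fin by simp
  finally show "expectation (\<lambda>\<omega>. (\<Sum>i\<in>I. a i * X i \<omega>)\<^sup>2) =
      (\<Sum>i\<in>I. (a i)\<^sup>2 * expectation (\<lambda>\<omega>. (X i \<omega>)\<^sup>2))" .
qed

section \<open>Deterministic bounds for a fixed value of the noise\<close>

lemma sensitivity_norm_le_1:
  fixes m q :: real
  assumes "m\<^sup>2 \<le> q" "q \<le> m" "m \<le> 1"
  defines "c \<equiv> 2 * m\<^sup>2 - q"
  shows "c\<^sup>2 + (c - m)\<^sup>2 + (1 - 2 * m + c)\<^sup>2 \<le> 1"
proof -
  have m: "0 \<le> m"
    using assms(1,2) zero_le_power2[of m] by linarith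
  \<comment> \<open>In terms of \<open>t\<close> and of the distance \<open>u\<close> of \<open>c\<close> to its upper end \<open>m\<^sup>2\<close>, the left-hand side is
    \<open>1 - 4 t + 3 t\<^sup>2 - 2 u + 6 t u + 3 u\<^sup>2\<close>, where \<open>0 \<le> u \<le> t \<le> 1 / 4\<close>.\<close>
  define t where "t = m * (1 - m)"
  have "0 \<le> t"
    using m assms(3) by (simp add: t_def)
  moreover have "t \<le> 1 / 4"
    using zero_le_power2[of "m - 1 / 2"] by (simp add: t_def power2_eq_square algebra_simps)
  ultimately have t: "0 \<le> t" "t \<le> 1 / 4"
    by auto
  define u where "u = q - m\<^sup>2"
  have u: "0 \<le> u" "u \<le> t"
    using assms(1,2) by (auto simp: u_def t_def power2_eq_square algebra_simps)
  \<comment> \<open>These bounds make the quadratic terms linear. The expression is then at most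
    \<open>1 - 13 / 4 * t + u / 4\<close>, hence at most \<open>1 - 3 * t\<close>, because
    \<open>u \<le> t\<close>. The value \<open>1\<close> is attained only for \<open>t = 0\<close>,
    that is, when all records are \<open>0\<close> or all are \<open>1\<close>.\<close>
  have "t * t \<le> 1 / 4 * t" "t * u \<le> 1 / 4 * u" "u * u \<le> u * t"
    using t u by (intro mult_right_mono mult_left_mono; simp)+
  moreover have "t * u = u * t"
    by simp
  moreover have "c\<^sup>2 + (c - m)\<^sup>2 + (1 - 2 * m + c)\<^sup>2 =
      1 - 4 * t + 3 * (t * t) - 2 * u + 6 * (t * u) + 3 * (u * u)"
    unfolding c_def t_def u_def by (simp add: power2_eq_square algebra_simps)
  ultimately show ?thesis
    using t u by linarith
qed

text \<open>The remainder does not depend on \<open>m\<close> and \<open>q\<close> and is a sum of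
  fourth powers over \<open>n\<close>, so its expectation is \<open>O(1 / n)\<close> uniformly over
  datasets.\<close>

lemma clip_quotient_error:
  fixes n m q z\<^sub>0 z\<^sub>1 z\<^sub>2 :: real
  assumes n: "1 \<le> n" and mq: "m\<^sup>2 \<le> q" "q \<le> m" "m \<le> 1"
  defines "c \<equiv> 2 * m\<^sup>2 - q"
  defines "N \<equiv> z\<^sub>0 + z\<^sub>1 + z\<^sub>2" and "S \<equiv> z\<^sub>1 / 2 + z\<^sub>2"
    and "L \<equiv> c * z\<^sub>0 + (c - m) * z\<^sub>1 + (1 - 2 * m + c) * z\<^sub>2"
  shows "n\<^sup>2 * (clip ((n * q + z\<^sub>2) / (n + N) - ((n * m + S) / (n + N))\<^sup>2) 0 (1 / 4) - (q - m\<^sup>2))\<^sup>2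
    \<le> L\<^sup>2 + (12 + 1296 * (z\<^sub>0 ^ 4 + z\<^sub>1 ^ 4 + z\<^sub>2 ^ 4)) / n"
proof -
  define w where "w = (n * q + z\<^sub>2) / (n + N) - ((n * m + S) / (n + N))\<^sup>2"
  define v where "v = q - m\<^sup>2"
  \<comment> \<open>\<open>B / (n + N)\<close> is the error of the noisy mean whenever
    \<open>n + N \<noteq> 0\<close>.\<close>
  define B where "B = S - m * N"
  define W where "W = \<bar>z\<^sub>0\<bar> + \<bar>z\<^sub>1\<bar> + \<bar>z\<^sub>2\<bar>"
  have m: "0 \<le> m"
    using mq zero_le_power2[of m] by linarith
  have v: "0 \<le> v" "v \<le> 1 / 4"
    using mq zero_le_power2[of "m - 1 / 2"] by (auto simp: v_def power2_eq_square algebra_simps)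
  have W: "0 \<le> W" "\<bar>N\<bar> \<le> W"
    by (auto simp: W_def N_def)
  have "c\<^sup>2 + (c - m)\<^sup>2 + (1 - 2 * m + c)\<^sup>2 \<le> 1"
    unfolding c_def by (rule sensitivity_norm_le_1) fact+
  then have "c\<^sup>2 \<le> 1" "(c - m)\<^sup>2 \<le> 1" "(1 - 2 * m + c)\<^sup>2 \<le> 1"
    using zero_le_power2[of c] zero_le_power2[of "c - m"] zero_le_power2[of "1 - 2 * m + c"]
    by linarith+
  then have "\<bar>c\<bar> \<le> 1" "\<bar>c - m\<bar> \<le> 1" "\<bar>1 - 2 * m + c\<bar> \<le> 1"
    by (simp_all add: abs_square_le_1)
  then have "\<bar>c * z\<^sub>0\<bar> \<le> \<bar>z\<^sub>0\<bar>" "\<bar>(c - m) * z\<^sub>1\<bar> \<le> \<bar>z\<^sub>1\<bar>" "\<bar>(1 - 2 * m + c) * z\<^sub>2\<bar> \<le> \<bar>z\<^sub>2\<bar>"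
    by (simp_all add: abs_mult mult_left_le_one_le)
  then have L: "\<bar>L\<bar> \<le> W"
    unfolding L_def W_def by linarith
  have "\<bar>(- m) * z\<^sub>0\<bar> \<le> \<bar>z\<^sub>0\<bar>" "\<bar>(1 / 2 - m) * z\<^sub>1\<bar> \<le> \<bar>z\<^sub>1\<bar>" "\<bar>(1 - m) * z\<^sub>2\<bar> \<le> \<bar>z\<^sub>2\<bar>"
    unfolding abs_mult using m mq(3) by (intro mult_left_le_one_le; simp add: abs_le_iff)+
  moreover have "B = (- m) * z\<^sub>0 + (1 / 2 - m) * z\<^sub>1 + (1 - m) * z\<^sub>2"
    by (simp add: B_def S_def N_def algebra_simps)
  ultimately have B: "\<bar>B\<bar> \<le> W"
    unfolding W_def by linarith
  have "(n * (clip w 0 (1 / 4) - v))\<^sup>2 \<le> L\<^sup>2 + (12 * W ^ 3 + 36 * W ^ 4) / n"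
  proof (cases "W \<le> n / 2")
    case True
    have d: "n / 2 \<le> n + N"
      using True W by linarith
    then have d0: "0 < n + N"
      using n by linarith
    \<comment> \<open>The first summand is the cost of replacing \<open>n / (n + N)\<close> by
      \<open>1\<close> in front of \<open>L\<close>; the second comes from the squared error of the
      mean.\<close>
    define T where "T = L * N / (n + N) + n * B\<^sup>2 / (n + N)\<^sup>2"
    have "(n * q + z\<^sub>2) / (n + N) = q + (z\<^sub>2 - q * N) / (n + N)"
      and "(n * m + S) / (n + N) = m + B / (n + N)"
      using d0 by (auto simp: B_def field_simps)
    then have "w = q + (z\<^sub>2 - q * N) / (n + N) - (m + B / (n + N))\<^sup>2"
      by (simp add: w_def)
    also have "\<dots> = v + (z\<^sub>2 - q * N - 2 * m * B) / (n + N) - B\<^sup>2 / (n + N)\<^sup>2"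
      by (simp add: v_def power2_sum power_divide diff_divide_distrib add_divide_distrib)
    \<comment> \<open>This is where the coefficients of \<open>L\<close> come from. For instance,
      \<open>z\<^sub>0\<close> enters \<open>N\<close> with coefficient \<open>1\<close> and
      \<open>B\<close> with coefficient \<open>- m\<close>, which gives
      \<open>- q + 2 * m\<^sup>2 = c\<close>.\<close>
    also have "z\<^sub>2 - q * N - 2 * m * B = L"
      by (simp add: L_def B_def S_def N_def c_def algebra_simps power2_eq_square)
    finally have "w - v = L / (n + N) - B\<^sup>2 / (n + N)\<^sup>2"
      by simp
    then have "n * (w - v) = n * L / (n + N) - n * B\<^sup>2 / (n + N)\<^sup>2"
      by (simp add: right_diff_distrib)
    also have "n * L / (n + N) = L - L * N / (n + N)"
      using d0 by (simp add: field_simps)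
    finally have wv: "n * (w - v) = L - T"
      by (simp add: T_def)
    have "\<bar>L * N / (n + N)\<bar> \<le> W * W / (n / 2)"
      using d d0 n L W unfolding abs_divide abs_mult
      by (intro frac_le mult_mono) auto
    moreover have "\<bar>n * B\<^sup>2 / (n + N)\<^sup>2\<bar> \<le> n * W\<^sup>2 / (n / 2)\<^sup>2"
      using d d0 n B W unfolding abs_divide abs_mult
      by (intro frac_le mult_mono power_mono) (auto intro: abs_le_square_iff[THEN iffD1])
    ultimately have "\<bar>T\<bar> \<le> W * W / (n / 2) + n * W\<^sup>2 / (n / 2)\<^sup>2"
      unfolding T_def by linarith
    also have "\<dots> = 6 * W\<^sup>2 / n"
      using n by (simp add: power2_eq_square field_simps)
    finally have T: "\<bar>T\<bar> \<le> 6 * W\<^sup>2 / n" .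
    \<comment> \<open>Clipping is 1-Lipschitz and fixes \<open>v\<close>, which lies in the clipping
      interval.\<close>
    have "\<bar>clip w 0 (1 / 4) - v\<bar> \<le> \<bar>w - v\<bar>"
      using v by (auto simp: clip_def)
    then have "(n * (clip w 0 (1 / 4) - v))\<^sup>2 \<le> (L - T)\<^sup>2"
      unfolding wv[symmetric] power_mult_distrib
      by (intro mult_left_mono) (simp_all add: abs_le_square_iff)
    also have "\<dots> = L\<^sup>2 - 2 * (L * T) + T\<^sup>2"
      by (simp add: power2_diff)
    also have "\<dots> \<le> L\<^sup>2 + 2 * (W * (6 * W\<^sup>2 / n)) + (6 * W\<^sup>2 / n)\<^sup>2"
    proof -
      have "\<bar>L * T\<bar> \<le> W * (6 * W\<^sup>2 / n)"
        unfolding abs_mult using L T W by (intro mult_mono) auto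
      moreover have "T\<^sup>2 \<le> (6 * W\<^sup>2 / n)\<^sup>2"
        using T by (meson abs_le_square_iff abs_ge_self order_trans)
      ultimately show ?thesis
        by linarith
    qed
    also have "(6 * W\<^sup>2 / n)\<^sup>2 \<le> 36 * W ^ 4 / n"
    proof -
      have "36 * W ^ 4 / n\<^sup>2 \<le> 36 * W ^ 4 / n"
        using n W by (intro divide_left_mono) (auto simp: power2_eq_square)
      then show ?thesis
        by (simp add: power_divide power_mult_distrib flip: power_mult)
    qed
    finally show ?thesis
      by (simp add: add_divide_distrib power3_eq_cube power2_eq_square)
  next
    case False
    \<comment> \<open>Both values lie in an interval of length \<open>1 / 4\<close>, whatever
      \<open>w\<close> is. In this case \<open>n + N\<close> may be \<open>0\<close> or
      negative.\<close>
    have "\<bar>clip w 0 (1 / 4) - v\<bar> \<le> 1 / 4"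
      using v unfolding clip_def by linarith
    then have "(clip w 0 (1 / 4) - v)\<^sup>2 \<le> (1 / 4)\<^sup>2"
      by (simp only: abs_le_square_iff[symmetric])
    then have "(n * (clip w 0 (1 / 4) - v))\<^sup>2 \<le> n\<^sup>2 * (1 / 4)\<^sup>2"
      unfolding power_mult_distrib by (intro mult_left_mono) auto
    also have "\<dots> = n ^ 3 / 16 / n"
      using n by (simp add: power2_eq_square power3_eq_cube)
    also have "\<dots> \<le> (12 * W ^ 3 + 36 * W ^ 4) / n"
    proof -
      have "n ^ 3 \<le> (2 * W) ^ 3"
        using n False by (intro power_mono) auto
      moreover have "(2 * W) ^ 3 = 8 * W ^ 3" "0 \<le> W ^ 3" "0 \<le> W ^ 4"
        using W by (auto simp: power_mult_distrib)
      ultimately have "n ^ 3 / 16 \<le> 12 * W ^ 3 + 36 * W ^ 4"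
        by linarith
      then show ?thesis
        using n by (intro divide_right_mono) auto
    qed
    finally show ?thesis
      using zero_le_power2[of L] by linarith
  qed
  \<comment> \<open>With \<open>W ^ 3 \<le> 1 + W ^ 4\<close> the numerator is at most
    \<open>12 + 48 * W ^ 4\<close>, and \<open>48 * 27 = 1296\<close>.\<close>
  also have "\<dots> \<le> L\<^sup>2 + (12 + 1296 * (z\<^sub>0 ^ 4 + z\<^sub>1 ^ 4 + z\<^sub>2 ^ 4)) / n"
  proof -
    have "W ^ 3 \<le> 1 + W ^ 4"
    proof (cases "W \<le> 1")
      case True
      then show ?thesis
        using W power_le_one[of W 3] zero_le_power[of W 4] by linarith
    next
      case False
      then show ?thesis
        using power_increasing[of 3 4 W] by linarith
    qed
    moreover have "W ^ 4 \<le> 27 * (z\<^sub>0 ^ 4 + z\<^sub>1 ^ 4 + z\<^sub>2 ^ 4)"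
    proof -
      \<comment> \<open>Cauchy-Schwarz, applied twice: first to the absolute values, then to the
        squares. This yields the factor \<open>3\<^sup>2 * 3 = 27\<close>.\<close>
      have sq: "(x + y + z)\<^sup>2 \<le> 3 * (x\<^sup>2 + y\<^sup>2 + z\<^sup>2)" for x y z :: real
        using zero_le_power2[of "x - y"] zero_le_power2[of "y - z"] zero_le_power2[of "x - z"]
        by (simp add: power2_eq_square algebra_simps)
      have "W ^ 4 = (W\<^sup>2)\<^sup>2"
        by simp
      also have "\<dots> \<le> (3 * (z\<^sub>0\<^sup>2 + z\<^sub>1\<^sup>2 + z\<^sub>2\<^sup>2))\<^sup>2"
        using sq[of "\<bar>z\<^sub>0\<bar>" "\<bar>z\<^sub>1\<bar>" "\<bar>z\<^sub>2\<bar>"] by (intro power_mono) (auto simp: W_def)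
      also have "\<dots> \<le> 27 * ((z\<^sub>0\<^sup>2)\<^sup>2 + (z\<^sub>1\<^sup>2)\<^sup>2 + (z\<^sub>2\<^sup>2)\<^sup>2)"
        using sq[of "z\<^sub>0\<^sup>2" "z\<^sub>1\<^sup>2" "z\<^sub>2\<^sup>2"] unfolding power_mult_distrib by simp
      finally show ?thesis
        by simp
    qed
    ultimately show ?thesis
      using n by (intro add_left_mono divide_right_mono) auto
  qed
  finally show ?thesis
    by (simp only: power_mult_distrib w_def v_def)
qed

section \<open>From datasets to their first two moments\<close>

lemma sum_list_moments:
  fixes D :: "real list" and a :: real
  shows "(\<Sum>x\<leftarrow>D. (1 - x)\<^sup>2) = length D - 2 * (\<Sum>x\<leftarrow>D. x) + (\<Sum>x\<leftarrow>D. x\<^sup>2)"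
    and "(\<Sum>x\<leftarrow>D. 2 * x * (1 - x)) = 2 * (\<Sum>x\<leftarrow>D. x) - 2 * (\<Sum>x\<leftarrow>D. x\<^sup>2)"
    and "(\<Sum>x\<leftarrow>D. (x - a)\<^sup>2) = (\<Sum>x\<leftarrow>D. x\<^sup>2) - 2 * a * (\<Sum>x\<leftarrow>D. x) + length D * a\<^sup>2"
  by (induction D) (auto simp: power2_eq_square algebra_simps)

text \<open>The coefficients \<open>a\<close> are chosen from \<open>D\<close> before
  \<open>\<omega>\<close>, so they are constants when the expectation is taken.\<close>

lemma var_estimator_error:
  fixes D :: "real list" and Z :: "nat \<Rightarrow> 'a \<Rightarrow> real"
  assumes "set D \<subseteq> {0..1}" and "1 \<le> length D"
  obtains a :: "nat \<Rightarrow> real" where "(\<Sum>i\<in>{0, 1, 2}. (a i)\<^sup>2) \<le> 1"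
    and "\<And>\<omega>. (real (length D))\<^sup>2 * (var_estimator Z D \<omega> - Var D)\<^sup>2 \<le>
      (\<Sum>i\<in>{0, 1, 2}. a i * Z i \<omega>)\<^sup>2 + (12 + 1296 * (\<Sum>i\<in>{0, 1, 2}. Z i \<omega> ^ 4)) / real (length D)"
proof -
  define n where "n = real (length D)"
  define m where "m = (\<Sum>x\<leftarrow>D. x) / n"
  define q where "q = (\<Sum>x\<leftarrow>D. x\<^sup>2) / n"
  have n: "1 \<le> n"
    using assms(2) by (simp add: n_def)
  have sum1: "(\<Sum>x\<leftarrow>D. x) = n * m" and sum2: "(\<Sum>x\<leftarrow>D. x\<^sup>2) = n * q"
    using n by (auto simp: m_def q_def)
  have "0 \<le> (\<Sum>x\<leftarrow>D. (x - m)\<^sup>2)"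
    by (intro sum_list_nonneg) auto
  also have "\<dots> = n * (q - m\<^sup>2)"
    unfolding sum_list_moments(3) sum1 sum2 n_def[symmetric]
    by (simp add: power2_eq_square algebra_simps)
  finally have mq1: "m\<^sup>2 \<le> q"
    using n by (simp add: zero_le_mult_iff)
  have "(\<Sum>x\<leftarrow>D. x\<^sup>2) \<le> (\<Sum>x\<leftarrow>D. x)"
    using assms(1) by (intro sum_list_mono) (auto simp: power2_eq_square mult_left_le)
  then have mq2: "q \<le> m"
    using n by (simp add: m_def q_def divide_right_mono)
  have "(\<Sum>x\<leftarrow>D. x) \<le> (\<Sum>x\<leftarrow>D. 1)"
    using assms(1) by (intro sum_list_mono) auto
  then have mq3: "m \<le> 1"
    using n unfolding sum1 by (simp add: sum_list_triv flip: n_def)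
  define c where "c = 2 * m\<^sup>2 - q"
  define a :: "nat \<Rightarrow> real"
    where "a i = (if i = 0 then c else if i = 1 then c - m else 1 - 2 * m + c)" for i
  have vare: "var_estimator Z D \<omega> =
      clip ((n * q + Z 2 \<omega>) / (n + (Z 0 \<omega> + Z 1 \<omega> + Z 2 \<omega>)) -
        ((n * m + (Z 1 \<omega> / 2 + Z 2 \<omega>)) / (n + (Z 0 \<omega> + Z 1 \<omega> + Z 2 \<omega>)))\<^sup>2) 0 (1 / 4)" for \<omega>
  proof -
    define b\<^sub>0 b\<^sub>1 b\<^sub>2 where "b\<^sub>0 = n - 2 * (n * m) + n * q + Z 0 \<omega>"
      and "b\<^sub>1 = 2 * (n * m) - 2 * (n * q) + Z 1 \<omega>" and "b\<^sub>2 = n * q + Z 2 \<omega>"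
    \<comment> \<open>The summands without noise are the quadratic Bernstein polynomials at the
      records: they add up to \<open>1\<close>, and half the middle one plus the last one is
      \<open>x\<close>.\<close>
    have "b\<^sub>0 + b\<^sub>1 + b\<^sub>2 = n + (Z 0 \<omega> + Z 1 \<omega> + Z 2 \<omega>)"
      and "b\<^sub>1 / 2 + b\<^sub>2 = n * m + (Z 1 \<omega> / 2 + Z 2 \<omega>)"
      by (simp_all add: b\<^sub>0_def b\<^sub>1_def b\<^sub>2_def field_simps)
    then show ?thesis
      unfolding var_estimator_def Let_def sum_list_moments(1,2) sum1 sum2 n_def[symmetric]
        b\<^sub>0_def[symmetric] b\<^sub>1_def[symmetric] b\<^sub>2_def[symmetric]
      by (simp only:)
  qed
  have var: "Var D = q - m\<^sup>2"
    by (simp add: Var_def m_def q_def n_def)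
  show thesis
  proof
    show "(\<Sum>i\<in>{0, 1, 2}. (a i)\<^sup>2) \<le> 1"
      using sensitivity_norm_le_1[OF mq1 mq2 mq3] by (simp add: a_def c_def add_ac)
    show "(real (length D))\<^sup>2 * (var_estimator Z D \<omega> - Var D)\<^sup>2 \<le>
      (\<Sum>i\<in>{0, 1, 2}. a i * Z i \<omega>)\<^sup>2 + (12 + 1296 * (\<Sum>i\<in>{0, 1, 2}. Z i \<omega> ^ 4)) / real (length D)"
      for \<omega>
      using clip_quotient_error[OF n mq1 mq2 mq3, of "Z 2 \<omega>" "Z 0 \<omega>" "Z 1 \<omega>"]
      unfolding vare var n_def[symmetric] by (simp add: a_def c_def add_ac)
  qed
qed

section \<open>Expectations and the supremum over datasets\<close>

text \<open>Passes from a pointwise real bound to the extended risk: \<open>g\<close> is nonnegative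
  and integrable, so its nonnegative integral is the real one, and the factor
  \<open>n\<^sup>2\<close> cancels.\<close>

lemma risk_le_integral:
  assumes "integrable M g" and "1 \<le> length D"
    and "\<And>\<omega>. (real (length D))\<^sup>2 * (fh D \<omega> - f D)\<^sup>2 \<le> g \<omega>"
  shows "risk M fh f D \<le> ennreal (\<integral>\<omega>. g \<omega> \<partial>M)"
proof -
  define n where "n = real (length D)"
  have n: "0 < n"
    using assms(2) unfolding n_def by linarith
  have g: "0 \<le> g \<omega>" for \<omega>
    using assms(3)[of \<omega>] by (rule order_trans[rotated]) simp
  have "(\<integral>\<^sup>+\<omega>. ennreal ((fh D \<omega> - f D)\<^sup>2) \<partial>M) \<le> (\<integral>\<^sup>+\<omega>. ennreal (g \<omega> / n\<^sup>2) \<partial>M)"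
    using assms(3) n by (intro nn_integral_mono ennreal_leI) (simp add: field_simps n_def)
  also have "\<dots> = ennreal ((\<integral>\<omega>. g \<omega> \<partial>M) / n\<^sup>2)"
    using assms(1) g by (subst nn_integral_eq_integral) auto
  finally have "risk M fh f D \<le> of_nat (length D) ^ 2 * ennreal ((\<integral>\<omega>. g \<omega> \<partial>M) / n\<^sup>2)"
    unfolding risk_def by (rule mult_left_mono) simp
  also have "of_nat (length D) ^ 2 = ennreal (n\<^sup>2)"
    by (simp add: n_def ennreal_of_nat_eq_real_of_nat ennreal_power)
  also have "ennreal (n\<^sup>2) * ennreal ((\<integral>\<omega>. g \<omega> \<partial>M) / n\<^sup>2) = ennreal (n\<^sup>2 * ((\<integral>\<omega>. g \<omega> \<partial>M) / n\<^sup>2))"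
    by (simp only: ennreal_mult' zero_le_power2)
  also have "n\<^sup>2 * ((\<integral>\<omega>. g \<omega> \<partial>M) / n\<^sup>2) = (\<integral>\<omega>. g \<omega> \<partial>M)"
    using n by simp
  finally show ?thesis .
qed

theorem theorem4:
  fixes M :: "'a measure" and Z :: "nat \<Rightarrow> 'a \<Rightarrow> real" and \<epsilon> :: real
  assumes "\<epsilon> > 0"
    and "prob_space M"
    and "prob_space.indep_vars M (\<lambda>_. borel) Z {0, 1, 2}"
    and "\<And>i. i \<in> {0, 1, 2} \<Longrightarrow>
           distributed M lborel (Z i) (\<lambda>t. ennreal (laplace_density (1 / \<epsilon>) t))"
  shows "\<exists>\<delta> :: nat \<Rightarrow> real. \<delta> \<longlonglongrightarrow> 0 \<and>
           (\<forall>n0\<ge>1. worst_risk M (var_estimator Z) Var n0 \<le> ennreal (2 / \<epsilon>\<^sup>2 * (1 + \<delta> n0)))"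
proof -
  interpret prob_space M by fact
  have b: "0 < 1 / \<epsilon>"
    using assms(1) by simp
  note mom = integrable_laplace_moment[OF assms(4) b] integral_laplace_moment[OF assms(4) b]
  \<comment> \<open>\<open>G\<close> involves the noise only, so the single constant
    \<open>K\<close> serves all datasets.\<close>
  define G where "G \<omega> = 12 + 1296 * (\<Sum>i\<in>{0, 1, 2}. Z i \<omega> ^ 4)" for \<omega>
  define K where "K = expectation G"
  have G: "integrable M G"
    unfolding G_def
    by (intro Bochner_Integration.integrable_add integrable_mult_right
        Bochner_Integration.integrable_sum mom(1)) auto
  have K: "0 \<le> K"
    unfolding K_def G_def by (intro integral_nonneg_AE AE_I2) auto
  have risk: "risk M (var_estimator Z) Var D \<le> ennreal (2 / \<epsilon>\<^sup>2 + K / n0)"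
    if D: "set D \<subseteq> {0..1}" and n0: "1 \<le> n0" "n0 \<le> length D" for D and n0 :: nat
  proof -
    have len: "1 \<le> length D"
      using n0 by simp
    obtain a where a: "(\<Sum>i\<in>{0, 1, 2}. (a i)\<^sup>2) \<le> 1"
      and err: "\<And>\<omega>. (real (length D))\<^sup>2 * (var_estimator Z D \<omega> - Var D)\<^sup>2 \<le>
        (\<Sum>i\<in>{0, 1, 2}. a i * Z i \<omega>)\<^sup>2 + G \<omega> / real (length D)"
      using var_estimator_error[OF D len] unfolding G_def by blast
    let ?L2 = "\<lambda>\<omega>. (\<Sum>i\<in>{0, 1, 2}. a i * Z i \<omega>)\<^sup>2"
    have Z1: "integrable M (Z i)" "expectation (Z i) = 0"
      and Z2: "integrable M (\<lambda>\<omega>. (Z i \<omega>)\<^sup>2)" "expectation (\<lambda>\<omega>. (Z i \<omega>)\<^sup>2) = 2 / \<epsilon>\<^sup>2"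
      if "i \<in> {0, 1, 2}" for i
      using mom(1)[OF that, of 1] mom(2)[OF that, of 1] mom(1)[OF that, of 2] mom(2)[OF that, of 2]
      by (simp_all add: power_one_over)
    have L2: "integrable M ?L2"
      by (rule expectation_square_lincomb_indep(1)[OF _ assms(3)]) (auto intro: Z1 Z2)
    have "expectation ?L2 = (\<Sum>i\<in>{0, 1, 2}. (a i)\<^sup>2 * expectation (\<lambda>\<omega>. (Z i \<omega>)\<^sup>2))"
      by (rule expectation_square_lincomb_indep(2)[OF _ assms(3)]) (auto intro: Z1 Z2)
    also have "\<dots> = 2 / \<epsilon>\<^sup>2 * (\<Sum>i\<in>{0, 1, 2}. (a i)\<^sup>2)"
      unfolding sum_distrib_left by (intro sum.cong refl) (simp only: Z2 mult.commute)
    \<comment> \<open>The leading constant is the second moment of one noise variable, as the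
      squared coefficients sum to at most \<open>1\<close>.\<close>
    also have "\<dots> \<le> 2 / \<epsilon>\<^sup>2"
      using a by (intro mult_left_le) auto
    finally have EL2: "expectation ?L2 \<le> 2 / \<epsilon>\<^sup>2" .
    have "risk M (var_estimator Z) Var D \<le>
        ennreal (expectation (\<lambda>\<omega>. ?L2 \<omega> + G \<omega> / real (length D)))"
      using L2 G len err
      by (intro risk_le_integral Bochner_Integration.integrable_add integrable_divide_zero) auto
    also have "expectation (\<lambda>\<omega>. ?L2 \<omega> + G \<omega> / real (length D)) =
        expectation ?L2 + K / real (length D)"
      using L2 G by (simp add: K_def)
    also have "\<dots> \<le> 2 / \<epsilon>\<^sup>2 + K / real n0"
      using EL2 K n0 by (intro add_mono divide_left_mono mult_pos_pos) auto
    finally show ?thesis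
      by (simp add: ennreal_leI)
  qed
  \<comment> \<open>Chosen so that
    \<open>2 / \<epsilon>\<^sup>2 * ?\<delta> n0 = K / n0\<close>.\<close>
  let ?\<delta> = "\<lambda>n0. (K * \<epsilon>\<^sup>2 / 2) / real n0"
  have "worst_risk M (var_estimator Z) Var n0 \<le> ennreal (2 / \<epsilon>\<^sup>2 * (1 + ?\<delta> n0))" if "1 \<le> n0" for n0
  proof -
    have "2 / \<epsilon>\<^sup>2 * (1 + ?\<delta> n0) = 2 / \<epsilon>\<^sup>2 + K / n0"
      using assms(1) by (simp add: distrib_left)
    then show ?thesis
      unfolding worst_risk_def using risk that by (auto intro!: SUP_least)
  qed
  moreover have "?\<delta> \<longlonglongrightarrow> 0"
    by (rule lim_const_over_n)
  ultimately show ?thesis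
    by blast
qed

end
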